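(* Let $(X,\Sigma,\mu)$ be a $\sigma$-finite measure space, let $1\le p\le\infty$ and $1\le q\le\infty$ with $\frac1p+\frac1q=1$. Let $l_A,l_B$ be positive integers, $G_A,G_B\in\Sigma$, and for $1\le i\le l_A$, $1\le j\le l_B$ let $a_i,b_j\in L_p(X,\mu)$, $c_i\in L_q(G_A,\mu)$, $e_j\in L_q(G_B,\mu)$. Let $A,B:L_p(X,\mu)\to L_p(X,\mu)$ be nonzero operators defined by $$(Ax)(t)=\int_{G_A}\sum_{i=1}^{l_A}a_i(t)c_i(s)x(s)\,d\mu_s,\qquad (Bx)(t)=\int_{G_B}\sum_{j=1}^{l_B}b_j(t)e_j(s)x(s)\,d\mu_s$$ for almost every $t$. Let $F(z)=\sum_{j=0}^n\delta_jz^j$ with $\delta_j\in\mathbb{R}$, $j=0,1,\dots,n$. Let $G=G_A\cap G_B$ and $$\gamma_{i_1}=1,\qquad \gamma_{i_1,\dots,i_m}=\prod_{l=1}^{m-1}Q_{G_A}(a_{i_{l+1}},c_{i_l}),\quad m\ge2.$$ Then $AB=BF(A)$ if and only if the following conditions are fulfilled: 1. for almost every $(t,s)\in X\times G$, $$-\sum_{k=1}^{l_B}\delta_0b_k(t)e_k(s)+\sum_{k=1}^{l_B}\sum_{m=1}^{l_A}a_m(t)Q_{G_A}(b_k,c_m)e_k(s)=\sum_{k=1}^{l_B}\sum_{j=1}^{n}\sum_{i_1,\dots,i_j=1}^{l_A}\delta_jb_k(t)Q_{G_B}(e_k,a_{i_1})\gamma_{i_1,\dots,i_j}c_{i_j}(s);$$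 2. for almost every $(t,s)\in X\times(G_A\setminus G)$, $$\sum_{k=1}^{l_B}\sum_{j=1}^n\sum_{i_1,\dots,i_j=1}^{l_A}\delta_jb_k(t)Q_{G_B}(e_k,a_{i_1})\gamma_{i_1,\dots,i_j}c_{i_j}(s)=0;$$ 3. for almost every $(t,s)\in X\times(G_B\setminus G)$, $$\sum_{k=1}^{l_B}\delta_0b_k(t)e_k(s)=\sum_{k=1}^{l_B}\sum_{m=1}^{l_A}Q_{G_A}(b_k,c_m)a_m(t)e_k(s).$$
   Context: $L_p(X,\mu)$ is the Banach space of (classes modulo null sets of) real-valued measurable functions on $X$ with $\int_X|f|^p\,d\mu<\infty$ ($1\le p<\infty$), or essentially bounded ($p=\infty$). For $G\in\Sigma$, $L_q(G,\mu)$ is the same with $X$ replaced by $G$. The relation $\frac1p+\frac1q=1$ uses $1/\infty=0$. The index in $\mu_s$ indicates the variable of integration. For $\Lambda\in\Sigma$ and functions $u,v$ on $\Lambda$ for which the integral exists and is finite, $Q_\Lambda(u,v)=\int_\Lambda u(t)v(t)\,d\mu$. For the polynomial $F$, $F(A)=\delta_0 I+\sum_{j=1}^n\delta_jA^j$. *)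

theory Defs
  imports "HOL-Analysis.Analysis"
begin

text \<open>The exponent \<open>p\<close> is an extended nonnegative real, so that \<open>1 / \<infinity> = 0\<close> holds in
  the relation \<open>1 / p + 1 / q = 1\<close>. For \<open>G \<in> sets M\<close>, the space of functions on \<open>G\<close> is obtained
  with the measure \<open>restrict_space M G\<close>.\<close>

definition Lp_fun :: "ennreal \<Rightarrow> 'a measure \<Rightarrow> ('a \<Rightarrow> real) set" where
  "Lp_fun p M = {f \<in> borel_measurable M.
     if p = \<infinity> then (\<exists>C. AE t in M. \<bar>f t\<bar> \<le> C)
     else (\<integral>\<^sup>+ t. ennreal (\<bar>f t\<bar> powr enn2real p) \<partial>M) < \<infinity>}"

definition Lp_rel :: "ennreal \<Rightarrow> 'a measure \<Rightarrow> (('a \<Rightarrow> real) \<times> ('a \<Rightarrow> real)) set" where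
  "Lp_rel p M = {(f, g). f \<in> Lp_fun p M \<and> g \<in> Lp_fun p M \<and> (AE t in M. f t = g t)}"

definition Lp :: "ennreal \<Rightarrow> 'a measure \<Rightarrow> ('a \<Rightarrow> real) set set" where
  "Lp p M = Lp_fun p M // Lp_rel p M"

definition Lp_zero :: "ennreal \<Rightarrow> 'a measure \<Rightarrow> ('a \<Rightarrow> real) set" where
  "Lp_zero p M = Lp_rel p M `` {\<lambda>t. 0}"

definition Lp_add ::
  "ennreal \<Rightarrow> 'a measure \<Rightarrow> ('a \<Rightarrow> real) set \<Rightarrow> ('a \<Rightarrow> real) set \<Rightarrow> ('a \<Rightarrow> real) set" where
  "Lp_add p M u v = (\<Union>f\<in>u. \<Union>g\<in>v. Lp_rel p M `` {\<lambda>t. f t + g t})"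

definition Lp_scale ::
  "ennreal \<Rightarrow> 'a measure \<Rightarrow> real \<Rightarrow> ('a \<Rightarrow> real) set \<Rightarrow> ('a \<Rightarrow> real) set" where
  "Lp_scale p M r u = (\<Union>f\<in>u. Lp_rel p M `` {\<lambda>t. r * f t})"

text \<open>\<open>op_poly p M \<delta> n A\<close> is the operator \<open>F(A) = \<delta> 0 I + (\<Sum>j = 1..n. \<delta> j A^j)\<close>, with the
  sum formed in the quotient space.\<close>

primrec op_poly ::
  "ennreal \<Rightarrow> 'a measure \<Rightarrow> (nat \<Rightarrow> real) \<Rightarrow> nat \<Rightarrow> (('a \<Rightarrow> real) set \<Rightarrow> ('a \<Rightarrow> real) set)
    \<Rightarrow> ('a \<Rightarrow> real) set \<Rightarrow> ('a \<Rightarrow> real) set" where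
  "op_poly p M \<delta> 0 A u = Lp_scale p M (\<delta> 0) u"
| "op_poly p M \<delta> (Suc n) A u =
     Lp_add p M (op_poly p M \<delta> n A u) (Lp_scale p M (\<delta> (Suc n)) ((A ^^ Suc n) u))"

definition Q :: "'a measure \<Rightarrow> 'a set \<Rightarrow> ('a \<Rightarrow> real) \<Rightarrow> ('a \<Rightarrow> real) \<Rightarrow> real" where
  "Q M \<Lambda> u v = (LINT t:\<Lambda>|M. u t * v t)"

text \<open>A multi-index \<open>(i\<^sub>1, \<dots>, i\<^sub>m)\<close> with entries in \<open>{1..l}\<close> is a function
  \<open>i \<in> {1..m} \<rightarrow>\<^sub>E {1..l}\<close>; for \<open>m = 1\<close> the product below is empty.\<close>

definition gam :: "'a measure \<Rightarrow> 'a set \<Rightarrow> (nat \<Rightarrow> 'a \<Rightarrow> real) \<Rightarrow> (nat \<Rightarrow> 'a \<Rightarrow> real)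
    \<Rightarrow> nat \<Rightarrow> (nat \<Rightarrow> nat) \<Rightarrow> real" where
  "gam M G a c m i = (\<Prod>l\<in>{1..<m}. Q M G (a (i (l + 1))) (c (i l)))"

lemma Lp_fun_add:
  assumes p: "1 \<le> p" and f: "f \<in> Lp_fun p M" and g: "g \<in> Lp_fun p M"
  shows "(\<lambda>t. f t + g t) \<in> Lp_fun p M"
proof (cases "p = \<infinity>")
  case True
  with f g obtain C D where C: "AE t in M. \<bar>f t\<bar> \<le> C" and D: "AE t in M. \<bar>g t\<bar> \<le> D"
    and [measurable]: "f \<in> borel_measurable M" "g \<in> borel_measurable M"
    by (auto simp: Lp_fun_def)
  have "AE t in M. \<bar>f t + g t\<bar> \<le> C + D"
    using C D by eventually_elim linarith
  then show ?thesis
    using True by (auto simp: Lp_fun_def)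
next
  case False
  define r where "r = enn2real p"
  have [measurable]: "f \<in> borel_measurable M" "g \<in> borel_measurable M"
    and fin: "(\<integral>\<^sup>+ t. ennreal (\<bar>f t\<bar> powr r) \<partial>M) < \<infinity>" "(\<integral>\<^sup>+ t. ennreal (\<bar>g t\<bar> powr r) \<partial>M) < \<infinity>"
    using f g False by (auto simp: Lp_fun_def r_def)
  have le: "\<bar>x + y\<bar> powr r \<le> 2 powr r * (\<bar>x\<bar> powr r + \<bar>y\<bar> powr r)" for x y :: real
  proof -
    have "\<bar>x + y\<bar> powr r \<le> (2 * max \<bar>x\<bar> \<bar>y\<bar>) powr r"
      by (rule powr_mono2) (auto simp: r_def)
    also have "\<dots> = 2 powr r * (max \<bar>x\<bar> \<bar>y\<bar>) powr r"
      by (simp add: powr_mult)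
    also have "\<dots> \<le> 2 powr r * (\<bar>x\<bar> powr r + \<bar>y\<bar> powr r)"
      by (intro mult_left_mono) (auto simp: max_def)
    finally show ?thesis .
  qed
  have "(\<integral>\<^sup>+ t. ennreal (\<bar>f t + g t\<bar> powr r) \<partial>M)
      \<le> (\<integral>\<^sup>+ t. ennreal (2 powr r) * (ennreal (\<bar>f t\<bar> powr r) + ennreal (\<bar>g t\<bar> powr r)) \<partial>M)"
    by (intro nn_integral_mono) (simp add: le ennreal_mult'[symmetric] flip: ennreal_plus)
  also have "\<dots> = ennreal (2 powr r) *
      ((\<integral>\<^sup>+ t. ennreal (\<bar>f t\<bar> powr r) \<partial>M) + (\<integral>\<^sup>+ t. ennreal (\<bar>g t\<bar> powr r) \<partial>M))"
    by (simp add: nn_integral_cmult nn_integral_add)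
  also have "\<dots> < \<infinity>"
    using fin by (simp add: ennreal_mult_less_top)
  finally show ?thesis
    using False by (simp add: Lp_fun_def r_def)
qed

lemma Lp_fun_scale:
  assumes "f \<in> Lp_fun p M"
  shows "(\<lambda>t. r * f t) \<in> Lp_fun p M"
proof (cases "p = \<infinity>")
  case True
  with assms obtain C where C: "AE t in M. \<bar>f t\<bar> \<le> C"
    and [measurable]: "f \<in> borel_measurable M"
    by (auto simp: Lp_fun_def)
  have "AE t in M. \<bar>r * f t\<bar> \<le> \<bar>r\<bar> * C"
    using C by eventually_elim (simp add: abs_mult mult_left_mono)
  then show ?thesis
    using True by (auto simp: Lp_fun_def)
next
  case False
  have [measurable]: "f \<in> borel_measurable M"
    and fin: "(\<integral>\<^sup>+ t. ennreal (\<bar>f t\<bar> powr enn2real p) \<partial>M) < \<infinity>"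
    using assms False by (auto simp: Lp_fun_def)
  have "(\<integral>\<^sup>+ t. ennreal (\<bar>r * f t\<bar> powr enn2real p) \<partial>M) =
      ennreal (\<bar>r\<bar> powr enn2real p) * (\<integral>\<^sup>+ t. ennreal (\<bar>f t\<bar> powr enn2real p) \<partial>M)"
    by (simp add: abs_mult powr_mult ennreal_mult' nn_integral_cmult)
  then show ?thesis
    using False fin by (simp add: Lp_fun_def ennreal_mult_less_top)
qed

lemma equiv_Lp_rel: "equiv (Lp_fun p M) (Lp_rel p M)"
proof (intro equivI)
  show "sym (Lp_rel p M)"
    by (auto simp: sym_def Lp_rel_def elim: eventually_mono)
  show "trans (Lp_rel p M)"
    unfolding trans_def Lp_rel_def by clarsimp
qed (auto simp: refl_on_def Lp_rel_def)

lemma Lp_add_class: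
  assumes p: "1 \<le> p" and f: "f \<in> Lp_fun p M" and g: "g \<in> Lp_fun p M"
  shows "Lp_add p M (Lp_rel p M `` {f}) (Lp_rel p M `` {g}) = Lp_rel p M `` {\<lambda>t. f t + g t}"
  unfolding Lp_add_def
proof (rule UN_equiv_class2[OF equiv_Lp_rel equiv_Lp_rel _ f g], rule congruent2I'[OF _])
  fix f1 f2 g1 g2
  assume "(f1, f2) \<in> Lp_rel p M" "(g1, g2) \<in> Lp_rel p M"
  then have "(\<lambda>t. f1 t + g1 t, \<lambda>t. f2 t + g2 t) \<in> Lp_rel p M"
    unfolding Lp_rel_def using p by (auto intro: Lp_fun_add)
  then show "Lp_rel p M `` {\<lambda>t. f1 t + g1 t} = Lp_rel p M `` {\<lambda>t. f2 t + g2 t}"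
    by (rule equiv_class_eq[OF equiv_Lp_rel])
qed

lemma Lp_scale_class:
  assumes f: "f \<in> Lp_fun p M"
  shows "Lp_scale p M r (Lp_rel p M `` {f}) = Lp_rel p M `` {\<lambda>t. r * f t}"
  unfolding Lp_scale_def
proof (rule UN_equiv_class[OF equiv_Lp_rel _ f], rule congruentI)
  fix f1 f2
  assume "(f1, f2) \<in> Lp_rel p M"
  then have "(\<lambda>t. r * f1 t, \<lambda>t. r * f2 t) \<in> Lp_rel p M"
    unfolding Lp_rel_def by (auto intro: Lp_fun_scale)
  then show "Lp_rel p M `` {\<lambda>t. r * f1 t} = Lp_rel p M `` {\<lambda>t. r * f2 t}"
    by (rule equiv_class_eq[OF equiv_Lp_rel])
qed

end

theory Submission
  imports Defs
begin

text \<open>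
  On representatives both operators have finite rank: \<open>A x = (\<Sum>m. Q(c\<^sub>m, x) a\<^sub>m)\<close> and
  \<open>B x = (\<Sum>k. Q(e\<^sub>k, x) b\<^sub>k)\<close>, all pairings being finite because the exponents are
  conjugate. Composing such
  sums multiplies pairings of neighbouring functions, so \<open>A\<^sup>j\<close> is a sum over multi-indices
  \<open>(i\<^sub>1, \<dots>, i\<^sub>j)\<close>, the factors \<open>\<gamma>\<close> collecting the inner pairings (\<open>rank_op_funpow\<close>). Consequently
  \<open>A B - B F(A)\<close> is the integral operator with the kernel
  \<open>K(t, s) = 1[s \<in> G\<^sub>B] (\<Sum>k. ((\<Sum>m. a\<^sub>m(t) Q(b\<^sub>k, c\<^sub>m)) - \<delta>\<^sub>0 b\<^sub>k(t)) e\<^sub>k(s))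
    - 1[s \<in> G\<^sub>A] (\<Sum>k j i. \<delta>\<^sub>j b\<^sub>k(t) Q(e\<^sub>k, a(i\<^sub>1)) \<gamma>\<^sub>i c(i\<^sub>j)(s))\<close>,
  a finite sum of products \<open>f\<^sub>r(t) g\<^sub>r(s)\<close>.

  The heart of the matter is that such a degenerate kernel induces the zero operator only if it
  vanishes almost everywhere (\<open>annihilates_Lp_iff_kernel_zero\<close>). The difficulty is that the null set of
  exceptional \<open>t\<close> depends on the function \<open>x\<close> to which the operator is applied. Finite rank removes it:
  \<open>\<integral> K(t,s)\<^sup>2 v(s) ds\<close> is, for each \<open>t\<close>, a linear combination of the values at \<open>t\<close> of the operator
  applied to the finitely many functions \<open>g\<^sub>r v\<close>, and these belong to \<open>L\<^sub>p\<close> when \<open>v\<close> is the indicator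
  of a set of finite measure on which the \<open>g\<^sub>r\<close> are bounded. Countably many such sets exhaust the space.

  Finally \<open>K = 0\<close> is read off separately over \<open>G\<close>, where both terms of \<open>K\<close> are present, over
  \<open>G\<^sub>A - G\<close> and over \<open>G\<^sub>B - G\<close>, where one of them is; outside \<open>G\<^sub>A \<union> G\<^sub>B\<close> the kernel vanishes anyway.
\<close>

section \<open>Duality between conjugate exponents\<close>

definition conjugate_exponents :: "ennreal \<Rightarrow> ennreal \<Rightarrow> bool" where
  "conjugate_exponents p q \<longleftrightarrow> 1 \<le> p \<and> 1 \<le> q \<and> 1 / p + 1 / q = 1"

lemma Lp_fun_measurable: "f \<in> Lp_fun p M \<Longrightarrow> f \<in> borel_measurable M"
  by (simp add: Lp_fun_def)

text \<open>The relation between \<open>p\<close> and \<open>q\<close> lives in the extended nonnegative reals; the cases separate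
  its two degenerate solutions from the real exponents to which Young's inequality applies.\<close>

lemma conjugate_exponents_cases:
  assumes "conjugate_exponents p q"
  obtains "p = 1" "q = \<infinity>" | "p = \<infinity>" "q = 1"
  | r r' where "p = ennreal r" "q = ennreal r'" "1 < r" "1 < r'" "1 / r + 1 / r' = 1"
proof -
  have p: "1 \<le> p" and q: "1 \<le> q" and pq: "1 / p + 1 / q = 1"
    using assms by (auto simp: conjugate_exponents_def)
  have eq1: "x = 1" if "1 \<le> x" "1 / x = 1" for x :: ennreal
  proof (cases x rule: ennreal_cases)
    case (real r)
    then have "1 \<le> r" using that by simp
    then have "ennreal (1 / r) = ennreal 1" using that real by (simp add: divide_ennreal flip: ennreal_1)
    then have "1 / r = 1" using \<open>1 \<le> r\<close> by (subst (asm) ennreal_inj) auto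
    then show ?thesis using real by simp
  next
    case top then show ?thesis using that by simp
  qed
  show ?thesis
  proof (cases p rule: ennreal_cases)
    case top
    then have "q = 1" using eq1[OF q] pq by simp
    then show ?thesis using that(2) top by (simp add: infinity_ennreal_def)
  next
    case P: (real r)
    show ?thesis
    proof (cases q rule: ennreal_cases)
      case top
      then have "p = 1" using eq1[OF p] pq by simp
      then show ?thesis using that(1) top by (simp add: infinity_ennreal_def)
    next
      case Q: (real r')
      have r: "1 \<le> r" "1 \<le> r'" using P Q p q by auto
      have "ennreal (1 / r + 1 / r') = ennreal (1 / r) + ennreal (1 / r')"
        using r by (intro ennreal_plus) auto
      also have "\<dots> = ennreal 1"
        using pq P Q r by (simp add: divide_ennreal flip: ennreal_1)
      finally have eq: "1 / r + 1 / r' = 1"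
        using r by (subst (asm) ennreal_inj) auto
      have "1 / r > 0" "1 / r' > 0" using r by auto
      then have "1 / r < 1" "1 / r' < 1" using eq by linarith+
      then have "1 < r" "1 < r'" using r by (auto simp: field_simps)
      then show ?thesis using that(3) P Q eq by blast
    qed
  qed
qed

lemma integrable_Lp_1: "integrable M f" if "f \<in> Lp_fun 1 M"
  using that by (auto simp: Lp_fun_def integrable_iff_bounded)

lemma integrable_mult_AE_bounded:
  fixes f g :: "'a \<Rightarrow> real"
  assumes f: "integrable M f" and g: "g \<in> borel_measurable M" "AE t in M. \<bar>g t\<bar> \<le> C"
  shows "integrable M (\<lambda>t. f t * g t)"
proof (rule Bochner_Integration.integrable_bound)
  show "integrable M (\<lambda>t. C * f t)" using f by simp
  show "(\<lambda>t. f t * g t) \<in> borel_measurable M" using f g by measurable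
  show "AE t in M. norm (f t * g t) \<le> norm (C * f t)"
    using g(2)
  proof eventually_elim
    case (elim t)
    then show ?case
      using mult_left_mono[OF elim, of "\<bar>f t\<bar>"] by (simp add: abs_mult mult.commute)
  qed
qed

lemma integrable_mult_Lp_conjugate:
  assumes pq: "conjugate_exponents p q" and f: "f \<in> Lp_fun p M" and g: "g \<in> Lp_fun q M"
  shows "integrable M (\<lambda>t. f t * g t)"
  using pq
proof (cases rule: conjugate_exponents_cases)
  case 1
  then show ?thesis
    using f g integrable_mult_AE_bounded[OF integrable_Lp_1] by (auto simp: Lp_fun_def)
next
  case 2
  then have "integrable M (\<lambda>t. g t * f t)"
    using f g integrable_mult_AE_bounded[OF integrable_Lp_1] by (auto simp: Lp_fun_def)
  then show ?thesis by (simp add: mult.commute)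
next
  case (3 r r')
  have [measurable]: "f \<in> borel_measurable M" "g \<in> borel_measurable M"
    using f g by (auto simp: Lp_fun_measurable)
  have "integrable M (\<lambda>t. \<bar>f t\<bar> powr r)" "integrable M (\<lambda>t. \<bar>g t\<bar> powr r')"
    using f g 3 by (auto simp: Lp_fun_def integrable_iff_bounded)
  then have "integrable M (\<lambda>t. \<bar>f t\<bar> powr r / r + \<bar>g t\<bar> powr r' / r')"
    by simp
  then show ?thesis
  proof (rule Bochner_Integration.integrable_bound)
    show "AE t in M. norm (f t * g t) \<le> norm (\<bar>f t\<bar> powr r / r + \<bar>g t\<bar> powr r' / r')"
      using 3 Youngs_inequality[of r r' "\<bar>f _\<bar>" "\<bar>g _\<bar>"] by (intro AE_I2) (simp add: abs_mult)
  qed simp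
qed

lemma Lp_fun_restrict:
  assumes S: "S \<in> sets M" and f: "f \<in> Lp_fun p M"
  shows "f \<in> Lp_fun p (restrict_space M S)"
proof -
  have [measurable]: "f \<in> borel_measurable M" using f by (rule Lp_fun_measurable)
  have S': "S \<inter> space M \<in> sets M" using S by simp
  have "(\<integral>\<^sup>+ t. ennreal (\<bar>f t\<bar> powr r) \<partial>restrict_space M S) \<le> (\<integral>\<^sup>+ t. ennreal (\<bar>f t\<bar> powr r) \<partial>M)" for r
    unfolding nn_integral_restrict_space[OF S']
    by (intro nn_integral_mono) (auto simp: indicator_def)
  then show ?thesis
    using f S' unfolding Lp_fun_def
    by (auto simp: AE_restrict_space_iff measurable_restrict_space1 intro: order_le_less_trans split: if_splits)
qed

lemma Lp_fun_zero: "(\<lambda>t. 0) \<in> Lp_fun p M"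
  by (auto simp: Lp_fun_def)

lemma Lp_fun_sum:
  assumes p: "1 \<le> p" and "finite I" and "\<And>i. i \<in> I \<Longrightarrow> f i \<in> Lp_fun p M"
  shows "(\<lambda>t. \<Sum>i\<in>I. f i t) \<in> Lp_fun p M"
  using assms(2,3)
  by (induction rule: finite_induct) (auto intro: Lp_fun_zero Lp_fun_add[OF p])

lemma Lp_fun_scale_right: "f \<in> Lp_fun p M \<Longrightarrow> (\<lambda>t. f t * r) \<in> Lp_fun p M"
  using Lp_fun_scale[of f p M r] by (simp add: mult.commute)

text \<open>This supplies the test functions: they lie in every \<open>L\<^sub>p\<close>, whatever the exponent.\<close>

lemma Lp_fun_bounded_on_finite_set:
  assumes [measurable]: "f \<in> borel_measurable M" "S \<in> sets M" and S: "emeasure M S < \<infinity>"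
    and bd: "\<And>t. t \<in> S \<Longrightarrow> \<bar>f t\<bar> \<le> C"
  shows "(\<lambda>t. indicator S t * f t) \<in> Lp_fun p M"
proof (cases "p = \<infinity>")
  case True
  have "AE t in M. \<bar>indicator S t * f t\<bar> \<le> max C 0"
    using bd by (intro AE_I2) (auto simp: indicator_def le_max_iff_disj)
  then show ?thesis using True by (auto simp: Lp_fun_def)
next
  case False
  define r where "r = enn2real p"
  have "(\<integral>\<^sup>+ t. ennreal (\<bar>indicator S t * f t\<bar> powr r) \<partial>M)
      \<le> (\<integral>\<^sup>+ t. ennreal (C powr r) * indicator S t \<partial>M)"
    using bd by (intro nn_integral_mono) (auto simp: indicator_def r_def intro!: ennreal_leI powr_mono2)
  also have "\<dots> < \<infinity>"
    using S by (simp add: nn_integral_cmult_indicator ennreal_mult_less_top)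
  finally show ?thesis using False by (simp add: Lp_fun_def r_def)
qed

lemma set_integrable_Lp_conjugate:
  assumes "conjugate_exponents p q" "S \<in> sets M"
    and "u \<in> Lp_fun q (restrict_space M S)" "x \<in> Lp_fun p M"
  shows "set_integrable M S (\<lambda>s. u s * x s)"
  using integrable_mult_Lp_conjugate[OF assms(1) Lp_fun_restrict[OF assms(2,4)] assms(3)] assms(2)
  by (simp add: integrable_restrict_space set_integrable_def mult.commute)

lemma Q_sum:
  assumes "\<And>i. i \<in> I \<Longrightarrow> set_integrable M S (\<lambda>s. u s * f i s)"
  shows "Q M S u (\<lambda>s. \<Sum>i\<in>I. f i s * r i) = (\<Sum>i\<in>I. Q M S u (f i) * r i)"
proof -
  have "Q M S u (\<lambda>s. \<Sum>i\<in>I. f i s * r i)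
      = (LINT s|M. (\<Sum>i\<in>I. indicator S s *\<^sub>R (u s * f i s) * r i))"
    unfolding Q_def set_lebesgue_integral_def
    by (intro Bochner_Integration.integral_cong refl) (simp add: sum_distrib_left mult.assoc)
  also have "\<dots> = (\<Sum>i\<in>I. (LINT s|M. indicator S s *\<^sub>R (u s * f i s) * r i))"
    using assms by (intro Bochner_Integration.integral_sum integrable_mult_left)
      (auto simp: set_integrable_def)
  finally show ?thesis
    by (simp add: Q_def set_lebesgue_integral_def)
qed

lemma Q_commute: "Q M S u v = Q M S v u"
  by (simp add: Q_def mult.commute)

section \<open>Degenerate kernels\<close>

text \<open>With \<open>K = (\<Sum>r. f\<^sub>r g\<^sub>r)\<close> and \<open>E\<close> a set of finite measure on which all \<open>g\<^sub>r\<close> are bounded, applying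
  the hypothesis to the finitely many functions \<open>x\<^sub>r = 1\<^sub>E g\<^sub>r\<close> and summing the results with weights
  \<open>f\<^sub>r(t)\<close> gives \<open>\<integral>\<^sub>E K(t, s)\<^sup>2 ds = 0\<close>. The exceptional set of \<open>t\<close> stays a null set because only
  countably many test functions occur.\<close>

lemma kernel_zero_if_annihilates_Lp:
  fixes f g :: "'r \<Rightarrow> 'a \<Rightarrow> real"
  assumes M: "sigma_finite_measure M" and R: "finite R"
    and g: "\<And>r. r \<in> R \<Longrightarrow> g r \<in> borel_measurable M"
    and int: "\<And>r x. r \<in> R \<Longrightarrow> x \<in> Lp_fun p M \<Longrightarrow> integrable M (\<lambda>s. g r s * x s)"
    and ann: "\<And>x. x \<in> Lp_fun p M \<Longrightarrow> AE t in M. (\<Sum>r\<in>R. f r t * (LINT s|M. g r s * x s)) = 0"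
  shows "AE t in M. AE s in M. (\<Sum>r\<in>R. f r t * g r s) = 0"
proof -
  interpret sigma_finite_measure M by (rule M)
  obtain D :: "nat \<Rightarrow> 'a set" where D: "range D \<subseteq> sets M" "(\<Union>i. D i) = space M"
      "\<And>i. emeasure M (D i) \<noteq> \<infinity>" "incseq D"
    using sigma_finite_incseq by blast
  have [measurable]: "D N \<in> sets M" for N using D(1) by auto
  \<comment> \<open>The cutoff \<open>N\<close> bounds both the support and the \<open>g r\<close>; the sets exhaust the space.\<close>
  define E where "E N = {s \<in> space M. s \<in> D N \<and> (\<forall>r\<in>R. \<bar>g r s\<bar> \<le> real N)}" for N
  have E [measurable]: "E N \<in> sets M" for N
  proof -
    have "{s \<in> space M. \<bar>g r s\<bar> \<le> real N} \<in> sets M" if "r \<in> R" for r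
      using g[OF that] by measurable
    then have "{s \<in> space M. \<forall>r\<in>R. \<bar>g r s\<bar> \<le> real N} \<in> sets M"
      using R by (intro sets.sets_Collect_finite_All)
    moreover have "E N = D N \<inter> {s \<in> space M. \<forall>r\<in>R. \<bar>g r s\<bar> \<le> real N}"
      by (auto simp: E_def)
    ultimately show ?thesis by simp
  qed
  have E_fin: "emeasure M (E N) < \<infinity>" for N
  proof -
    have "emeasure M (E N) \<le> emeasure M (D N)" by (rule emeasure_mono) (auto simp: E_def)
    then show ?thesis using D(3)[of N] by (simp add: less_top order_le_less_trans)
  qed
  define x where "x N r = (\<lambda>s. indicator (E N) s * g r s)" for N r
  have x: "x N r \<in> Lp_fun p M" if "r \<in> R" for N r
    unfolding x_def
  proof (rule Lp_fun_bounded_on_finite_set[OF g[OF that] E E_fin])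
    show "\<bar>g r s\<bar> \<le> real N" if "s \<in> E N" for s
      using that \<open>r \<in> R\<close> by (simp add: E_def)
  qed
  have "AE t in M. \<forall>N. \<forall>r\<in>R. (\<Sum>r'\<in>R. f r' t * (LINT s|M. g r' s * x N r s)) = 0"
    unfolding AE_all_countable using R ann[OF x] by (simp add: AE_finite_all)
  then show ?thesis
  proof eventually_elim
    case (elim t)
    let ?K = "\<lambda>s. \<Sum>r\<in>R. f r t * g r s"
    \<comment> \<open>Only one factor \<open>K\<close> of the square keeps its integral; the other is expanded over \<open>r\<close>, which
      turns the pieces into test functions.\<close>
    have "AE s in M. indicator (E N) s * (?K s)\<^sup>2 = 0" for N
    proof -
      have sq: "indicator (E N) s * (?K s)\<^sup>2 = (\<Sum>r\<in>R. f r t * (\<Sum>r'\<in>R. f r' t * (g r' s * x N r s)))" for s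
        by (simp add: power2_eq_square x_def sum_product sum_distrib_left mult_ac)
      have int': "integrable M (\<lambda>s. f r t * (\<Sum>r'\<in>R. f r' t * (g r' s * x N r s)))" if "r \<in> R" for r
        using that int x by (intro integrable_mult_right Bochner_Integration.integrable_sum) auto
      have "(LINT s|M. indicator (E N) s * (?K s)\<^sup>2)
          = (\<Sum>r\<in>R. f r t * (\<Sum>r'\<in>R. f r' t * (LINT s|M. g r' s * x N r s)))"
        unfolding sq using int int' x by (simp add: Bochner_Integration.integral_sum)
      also have "\<dots> = 0" using elim by simp
      finally have "(LINT s|M. indicator (E N) s * (?K s)\<^sup>2) = 0" .
      moreover have "integrable M (\<lambda>s. indicator (E N) s * (?K s)\<^sup>2)"
        unfolding sq using int' by (rule Bochner_Integration.integrable_sum)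
      ultimately show ?thesis
        by (subst (asm) integral_nonneg_eq_0_iff_AE) auto
    qed
    then have "AE s in M. \<forall>N. indicator (E N) s * (?K s)\<^sup>2 = 0"
      unfolding AE_all_countable by blast
    then show ?case
    proof (rule AE_mp, intro AE_I2 impI)
      fix s assume s: "s \<in> space M" and 0: "\<forall>N. indicator (E N) s * (?K s)\<^sup>2 = 0"
      obtain i where i: "s \<in> D i" using s D(2) by blast
      define N where "N = max i (nat \<lceil>\<Sum>r\<in>R. \<bar>g r s\<bar>\<rceil>)"
      have "s \<in> D N" using i incseqD[OF D(4), of i N] by (auto simp: N_def)
      moreover have "\<bar>g r s\<bar> \<le> real N" if "r \<in> R" for r
      proof -
        have "\<bar>g r s\<bar> \<le> (\<Sum>r\<in>R. \<bar>g r s\<bar>)" using that R by (intro member_le_sum) auto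
        also have "\<dots> \<le> real N" unfolding N_def by linarith
        finally show ?thesis .
      qed
      ultimately have "s \<in> E N" using s by (simp add: E_def)
      then show "?K s = 0" using 0[rule_format, of N] by simp
    qed
  qed
qed

text \<open>For the direction from right to left, a section of the kernel that vanishes almost everywhere
  integrates to zero against every \<open>x\<close>, and the exceptional set of \<open>t\<close> is the same for all \<open>x\<close>.\<close>

lemma annihilates_Lp_iff_kernel_zero:
  fixes f g :: "'r \<Rightarrow> 'a \<Rightarrow> real"
  assumes M: "sigma_finite_measure M" and R: "finite R"
    and g: "\<And>r. r \<in> R \<Longrightarrow> g r \<in> borel_measurable M"
    and int: "\<And>r x. r \<in> R \<Longrightarrow> x \<in> Lp_fun p M \<Longrightarrow> integrable M (\<lambda>s. g r s * x s)"
  shows "(\<forall>x\<in>Lp_fun p M. AE t in M. (\<Sum>r\<in>R. f r t * (LINT s|M. g r s * x s)) = 0)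
    \<longleftrightarrow> (AE t in M. AE s in M. (\<Sum>r\<in>R. f r t * g r s) = 0)"
proof
  assume "\<forall>x\<in>Lp_fun p M. AE t in M. (\<Sum>r\<in>R. f r t * (LINT s|M. g r s * x s)) = 0"
  then show "AE t in M. AE s in M. (\<Sum>r\<in>R. f r t * g r s) = 0"
    using kernel_zero_if_annihilates_Lp[where f = f and g = g and p = p, OF M R g int] by blast
next
  assume K: "AE t in M. AE s in M. (\<Sum>r\<in>R. f r t * g r s) = 0"
  show "\<forall>x\<in>Lp_fun p M. AE t in M. (\<Sum>r\<in>R. f r t * (LINT s|M. g r s * x s)) = 0"
  proof
    fix x assume x: "x \<in> Lp_fun p M"
    show "AE t in M. (\<Sum>r\<in>R. f r t * (LINT s|M. g r s * x s)) = 0"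
      using K
    proof eventually_elim
      case (elim t)
      have "(\<Sum>r\<in>R. f r t * (LINT s|M. g r s * x s)) = (LINT s|M. (\<Sum>r\<in>R. f r t * g r s) * x s)"
        using int x by (simp add: sum_distrib_right mult.assoc Bochner_Integration.integral_sum)
      also have "\<dots> = 0"
        by (rule integral_eq_zero_AE) (use elim in auto)
      finally show ?case .
    qed
  qed
qed

text \<open>Iterated null sets are null sets of the product only for measurable sets, hence the joint
  measurability of \<open>K\<close>. It is asked for on the whole product, so that a single kernel can be restricted
  to several strips.\<close>

lemma AE_pair_restrict_space_iff:
  assumes M: "sigma_finite_measure M" and S: "S \<in> sets M"
    and K: "case_prod K \<in> borel_measurable (M \<Otimes>\<^sub>M M)"
  shows "(AE (t, s) in M \<Otimes>\<^sub>M restrict_space M S. K t s = (0::real))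
    \<longleftrightarrow> (AE t in M. AE s in M. s \<in> S \<longrightarrow> K t s = 0)"
proof -
  interpret sigma_finite_measure M by (rule M)
  interpret S: sigma_finite_measure "restrict_space M S"
    by (rule sigma_finite_measure_restrict_space[OF M S])
  interpret P: pair_sigma_finite M "restrict_space M S" ..
  have S': "S \<inter> space M \<in> sets M" using S by simp
  have "(\<lambda>z. (fst z, snd z)) \<in> M \<Otimes>\<^sub>M restrict_space M S \<rightarrow>\<^sub>M M \<Otimes>\<^sub>M M"
    by (intro measurable_Pair measurable_fst measurable_compose[OF measurable_snd]
        measurable_restrict_space1 measurable_ident_sets refl)
  from measurable_compose[OF this K]
  have [measurable]: "(\<lambda>z. K (fst z) (snd z)) \<in> borel_measurable (M \<Otimes>\<^sub>M restrict_space M S)"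
    by simp
  have "{z \<in> space (M \<Otimes>\<^sub>M restrict_space M S). K (fst z) (snd z) = 0} \<in> sets (M \<Otimes>\<^sub>M restrict_space M S)"
    by measurable
  from P.AE_pair_iff[OF this] show ?thesis
    by (simp add: AE_restrict_space_iff[OF S'] split_beta')
qed

section \<open>Operators of finite rank and their powers\<close>

definition rank_op :: "'a measure \<Rightarrow> 'a set \<Rightarrow> (nat \<Rightarrow> 'a \<Rightarrow> real) \<Rightarrow> (nat \<Rightarrow> 'a \<Rightarrow> real)
    \<Rightarrow> nat \<Rightarrow> ('a \<Rightarrow> real) \<Rightarrow> 'a \<Rightarrow> real" where
  "rank_op M S a c l x = (\<lambda>t. \<Sum>i=1..l. a i t * Q M S (c i) x)"

lemma rank_op_in_Lp:
  assumes "1 \<le> p" and "\<And>i. i \<in> {1..l} \<Longrightarrow> a i \<in> Lp_fun p M"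
  shows "rank_op M S a c l x \<in> Lp_fun p M"
  unfolding rank_op_def using assms by (intro Lp_fun_sum Lp_fun_scale_right) auto

lemma rank_op_funpow_in_Lp:
  assumes "1 \<le> p" and "\<And>i. i \<in> {1..l} \<Longrightarrow> a i \<in> Lp_fun p M" and "x \<in> Lp_fun p M"
  shows "(rank_op M S a c l ^^ j) x \<in> Lp_fun p M"
  using assms(3) by (induction j) (auto intro: rank_op_in_Lp assms(1,2))

lemma Q_rank_op:
  assumes pq: "conjugate_exponents p q" "S \<in> sets M" and u: "u \<in> Lp_fun q (restrict_space M S)"
    and a: "\<And>i. i \<in> {1..l} \<Longrightarrow> a i \<in> Lp_fun p M"
  shows "Q M S u (rank_op M S' a c l x) = (\<Sum>m=1..l. Q M S u (a m) * Q M S' (c m) x)"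
  unfolding rank_op_def
  by (rule Q_sum) (use set_integrable_Lp_conjugate[OF pq u] a in auto)

text \<open>The last entry is the one to split off, because it indexes the functional that an additional
  factor \<open>A\<close>, applied first, hits.\<close>

lemma sum_multi_index_Suc:
  fixes \<phi> :: "(nat \<Rightarrow> 'b) \<Rightarrow> real"
  shows "(\<Sum>i\<in>{1..Suc j} \<rightarrow>\<^sub>E I. \<phi> i) = (\<Sum>i\<in>{1..j} \<rightarrow>\<^sub>E I. \<Sum>m\<in>I. \<phi> (i(Suc j := m)))"
proof -
  have ins: "{1..Suc j} = insert (Suc j) {1..j}" by auto
  have "(\<Sum>i\<in>{1..Suc j} \<rightarrow>\<^sub>E I. \<phi> i) = (\<Sum>z\<in>I \<times> ({1..j} \<rightarrow>\<^sub>E I). \<phi> ((snd z)(Suc j := fst z)))"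
    unfolding ins PiE_insert_eq
    by (subst sum.reindex[OF inj_combinator]) (auto simp: case_prod_beta)
  also have "\<dots> = (\<Sum>m\<in>I. \<Sum>i\<in>{1..j} \<rightarrow>\<^sub>E I. \<phi> (i(Suc j := m)))"
    by (simp add: sum.cartesian_product split_beta')
  also have "\<dots> = (\<Sum>i\<in>{1..j} \<rightarrow>\<^sub>E I. \<Sum>m\<in>I. \<phi> (i(Suc j := m)))"
    by (rule sum.swap)
  finally show ?thesis .
qed

lemma gam_Suc:
  assumes "1 \<le> j"
  shows "gam M S a c (Suc j) (i(Suc j := m)) = gam M S a c j i * Q M S (c (i j)) (a m)"
proof -
  have "gam M S a c (Suc j) (i(Suc j := m)) =
      (\<Prod>l\<in>{1..<Suc j}. Q M S (a ((i(Suc j := m)) (l + 1))) (c (i l)))"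
    unfolding gam_def by (intro prod.cong) auto
  also have "\<dots> = (\<Prod>l\<in>{1..<j}. Q M S (a ((i(Suc j := m)) (l + 1))) (c (i l))) * Q M S (a m) (c (i j))"
    using assms by (simp add: prod.atLeastLessThan_Suc)
  also have "(\<Prod>l\<in>{1..<j}. Q M S (a ((i(Suc j := m)) (l + 1))) (c (i l))) = gam M S a c j i"
    unfolding gam_def by (intro prod.cong) auto
  finally show ?thesis by (simp only: Q_commute[of M S "a m"])
qed

text \<open>Writing \<open>A\<^bsup>j+1\<^esup> x = A\<^sup>j (A x)\<close>, the functional \<open>Q(c(i\<^sub>j), \<cdot>)\<close> is applied to \<open>A x\<close> and yields
  \<open>(\<Sum>m. Q(c(i\<^sub>j), a\<^sub>m) Q(c\<^sub>m, x))\<close>: one more entry \<open>m\<close> in the multi-index and one more factor in \<open>\<gamma>\<close>.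
  There is no analogue for \<open>j = 0\<close>, since the identity need not have finite rank.\<close>

lemma rank_op_funpow:
  assumes pq: "conjugate_exponents p q" "S \<in> sets M"
    and a: "\<And>i. i \<in> {1..l} \<Longrightarrow> a i \<in> Lp_fun p M"
    and c: "\<And>i. i \<in> {1..l} \<Longrightarrow> c i \<in> Lp_fun q (restrict_space M S)"
    and j: "1 \<le> j"
  shows "(rank_op M S a c l ^^ j) x
    = (\<lambda>t. \<Sum>i\<in>{1..j} \<rightarrow>\<^sub>E {1..l}. a (i 1) t * (gam M S a c j i * Q M S (c (i j)) x))"
  using j
proof (induction j arbitrary: x rule: dec_induct)
  case base
  show ?case
    using sum_multi_index_Suc[of _ 0 "{1..l}"]
    by (simp add: rank_op_def gam_def PiE_empty_domain)
next
  case (step j)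
  show ?case
  proof
    fix t
    have "(rank_op M S a c l ^^ Suc j) x t = (rank_op M S a c l ^^ j) (rank_op M S a c l x) t"
      by (simp only: funpow_Suc_right o_apply)
    also have "\<dots> = (\<Sum>i\<in>{1..j} \<rightarrow>\<^sub>E {1..l}. a (i 1) t *
        (gam M S a c j i * Q M S (c (i j)) (rank_op M S a c l x)))"
      by (simp only: step.IH)
    also have "\<dots> = (\<Sum>i\<in>{1..j} \<rightarrow>\<^sub>E {1..l}. \<Sum>m=1..l. a (i 1) t *
        (gam M S a c j i * Q M S (c (i j)) (a m) * Q M S (c m) x))"
    proof (rule sum.cong[OF refl])
      fix i assume i: "i \<in> {1..j} \<rightarrow>\<^sub>E {1..l}"
      have "i j \<in> {1..l}" using step.hyps by (intro PiE_mem[OF i]) simp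
      then show "a (i 1) t * (gam M S a c j i * Q M S (c (i j)) (rank_op M S a c l x))
          = (\<Sum>m=1..l. a (i 1) t * (gam M S a c j i * Q M S (c (i j)) (a m) * Q M S (c m) x))"
        by (subst Q_rank_op[OF pq c a]) (simp_all add: sum_distrib_left mult.assoc)
    qed
    also have "\<dots> = (\<Sum>i\<in>{1..Suc j} \<rightarrow>\<^sub>E {1..l}. a (i 1) t *
        (gam M S a c (Suc j) i * Q M S (c (i (Suc j))) x))"
      unfolding sum_multi_index_Suc gam_Suc[OF step.hyps(1)]
      using step.hyps by (intro sum.cong refl) simp
    finally show "(rank_op M S a c l ^^ Suc j) x t = (\<Sum>i\<in>{1..Suc j} \<rightarrow>\<^sub>E {1..l}. a (i 1) t *
        (gam M S a c (Suc j) i * Q M S (c (i (Suc j))) x))" .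
  qed
qed

section \<open>Passing to classes of functions\<close>

lemma Lp_class_in_Lp: "x \<in> Lp_fun p M \<Longrightarrow> Lp_rel p M `` {x} \<in> Lp p M"
  unfolding Lp_def by (rule quotientI)

lemma Ball_Lp_iff: "(\<forall>u\<in>Lp p M. P u) \<longleftrightarrow> (\<forall>x\<in>Lp_fun p M. P (Lp_rel p M `` {x}))"
  unfolding Lp_def by (auto simp: quotient_def)

lemma Lp_class_eq_iff:
  assumes "x \<in> Lp_fun p M" "y \<in> Lp_fun p M"
  shows "Lp_rel p M `` {x} = Lp_rel p M `` {y} \<longleftrightarrow> (AE t in M. x t = y t)"
  using eq_equiv_class_iff[OF equiv_Lp_rel assms] assms by (simp add: Lp_rel_def)

text \<open>The operator is given by its values on classes, with an integral formula for every choice of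
  representatives. As the image is again a class, the formula determines it.\<close>

lemma integral_operator_class:
  assumes pq: "conjugate_exponents p q" "S \<in> sets M"
    and a: "\<And>i. i \<in> {1..l} \<Longrightarrow> a i \<in> Lp_fun p M"
    and c: "\<And>i. i \<in> {1..l} \<Longrightarrow> c i \<in> Lp_fun q (restrict_space M S)"
    and T: "T \<in> Lp p M \<rightarrow> Lp p M"
    and eq: "\<And>u x y. u \<in> Lp p M \<Longrightarrow> x \<in> u \<Longrightarrow> y \<in> T u \<Longrightarrow>
           AE t in M. y t = (LINT s:S|M. (\<Sum>i=1..l. a i t * c i s * x s))"
    and x: "x \<in> Lp_fun p M"
  shows "T (Lp_rel p M `` {x}) = Lp_rel p M `` {rank_op M S a c l x}"
proof -
  have p: "1 \<le> p" using pq by (simp add: conjugate_exponents_def)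
  let ?u = "Lp_rel p M `` {x}"
  have u: "?u \<in> Lp p M" using x by (rule Lp_class_in_Lp)
  then have "T ?u \<in> Lp p M" using T by auto
  then obtain y where y: "y \<in> Lp_fun p M" "T ?u = Lp_rel p M `` {y}"
    unfolding Lp_def by (auto elim: quotientE)
  have mem: "x \<in> ?u" "y \<in> T ?u"
    using x y equiv_class_self[OF equiv_Lp_rel] by auto
  have "(LINT s:S|M. (\<Sum>i=1..l. a i t * c i s * x s)) = rank_op M S a c l x t" for t
  proof -
    have "(LINT s:S|M. (\<Sum>i=1..l. a i t * c i s * x s))
        = (LINT s|M. (\<Sum>i=1..l. a i t * (indicator S s *\<^sub>R (c i s * x s))))"
      unfolding set_lebesgue_integral_def
      by (intro Bochner_Integration.integral_cong refl) (simp add: sum_distrib_left mult_ac)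
    also have "\<dots> = (\<Sum>i=1..l. (LINT s|M. a i t * (indicator S s *\<^sub>R (c i s * x s))))"
      using set_integrable_Lp_conjugate[OF pq c x] unfolding set_integrable_def
      by (intro Bochner_Integration.integral_sum integrable_mult_right) auto
    also have "\<dots> = rank_op M S a c l x t"
      by (simp only: integral_mult_right_zero rank_op_def Q_def set_lebesgue_integral_def)
    finally show ?thesis .
  qed
  with eq[OF u mem] have "AE t in M. y t = rank_op M S a c l x t" by simp
  then show ?thesis
    using y Lp_class_eq_iff[OF y(1) rank_op_in_Lp[OF p a]] by simp
qed

lemma funpow_class:
  assumes T: "\<And>x. x \<in> Lp_fun p M \<Longrightarrow> T (Lp_rel p M `` {x}) = Lp_rel p M `` {\<tau> x}"
    and \<tau>: "\<And>x. x \<in> Lp_fun p M \<Longrightarrow> \<tau> x \<in> Lp_fun p M"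
    and x: "x \<in> Lp_fun p M"
  shows "(T ^^ j) (Lp_rel p M `` {x}) = Lp_rel p M `` {(\<tau> ^^ j) x} \<and> (\<tau> ^^ j) x \<in> Lp_fun p M"
  by (induction j) (auto simp: x T \<tau>)

text \<open>Since \<open>\<tau>\<^sup>0\<close> is the identity, the constant term of \<open>F\<close> can be treated as the summand \<open>j = 0\<close>.\<close>

lemma op_poly_class:
  assumes p: "1 \<le> p"
    and T: "\<And>x. x \<in> Lp_fun p M \<Longrightarrow> T (Lp_rel p M `` {x}) = Lp_rel p M `` {\<tau> x}"
    and \<tau>: "\<And>x. x \<in> Lp_fun p M \<Longrightarrow> \<tau> x \<in> Lp_fun p M"
    and x: "x \<in> Lp_fun p M"
  shows "op_poly p M \<delta> n T (Lp_rel p M `` {x})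
      = Lp_rel p M `` {\<lambda>t. \<Sum>j\<le>n. (\<tau> ^^ j) x t * \<delta> j}"
proof (induction n)
  case 0
  show ?case using x by (simp add: Lp_scale_class mult.commute)
next
  case (Suc n)
  note pow = funpow_class[where T = T and \<tau> = \<tau>, OF T \<tau> x]
  have mem: "(\<lambda>t. (\<tau> ^^ j) x t * \<delta> j) \<in> Lp_fun p M" for j
    using pow by (intro Lp_fun_scale_right) blast
  have "Lp_scale p M (\<delta> (Suc n)) ((T ^^ Suc n) (Lp_rel p M `` {x}))
      = Lp_rel p M `` {\<lambda>t. (\<tau> ^^ Suc n) x t * \<delta> (Suc n)}"
    using pow[of "Suc n"] by (simp only: Lp_scale_class mult.commute)
  then show ?case
    using Suc.IH mem p by (simp only: op_poly.simps Lp_add_class Lp_fun_sum finite_atMost sum.atMost_Suc)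
qed

section \<open>The commutation relation\<close>

theorem theorem2:
  fixes M :: "'a measure" and p q :: ennreal
    and lA lB n :: nat
    and GA GB G :: "'a set"
    and a b c e :: "nat \<Rightarrow> 'a \<Rightarrow> real"
    and A B :: "('a \<Rightarrow> real) set \<Rightarrow> ('a \<Rightarrow> real) set"
    and \<delta> :: "nat \<Rightarrow> real"
  assumes "sigma_finite_measure M"
    and "1 \<le> p" and "1 \<le> q" and "1 / p + 1 / q = 1"
    and "1 \<le> lA" and "1 \<le> lB"
    and "GA \<in> sets M" and "GB \<in> sets M"
    and "\<And>i. i \<in> {1..lA} \<Longrightarrow> a i \<in> Lp_fun p M"
    and "\<And>j. j \<in> {1..lB} \<Longrightarrow> b j \<in> Lp_fun p M"
    and "\<And>i. i \<in> {1..lA} \<Longrightarrow> c i \<in> Lp_fun q (restrict_space M GA)"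
    and "\<And>j. j \<in> {1..lB} \<Longrightarrow> e j \<in> Lp_fun q (restrict_space M GB)"
    and "A \<in> Lp p M \<rightarrow> Lp p M" and "B \<in> Lp p M \<rightarrow> Lp p M"
    and "\<And>u x y. u \<in> Lp p M \<Longrightarrow> x \<in> u \<Longrightarrow> y \<in> A u \<Longrightarrow>
           AE t in M. y t = (LINT s:GA|M. (\<Sum>i=1..lA. a i t * c i s * x s))"
    and "\<And>u x y. u \<in> Lp p M \<Longrightarrow> x \<in> u \<Longrightarrow> y \<in> B u \<Longrightarrow>
           AE t in M. y t = (LINT s:GB|M. (\<Sum>j=1..lB. b j t * e j s * x s))"
    and "\<exists>u\<in>Lp p M. A u \<noteq> Lp_zero p M" and "\<exists>u\<in>Lp p M. B u \<noteq> Lp_zero p M"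
    and "G = GA \<inter> GB"
  shows "(\<forall>u\<in>Lp p M. A (B u) = B (op_poly p M \<delta> n A u)) \<longleftrightarrow>
    (AE (t, s) in M \<Otimes>\<^sub>M restrict_space M G.
       - (\<Sum>k=1..lB. \<delta> 0 * b k t * e k s)
         + (\<Sum>k=1..lB. \<Sum>m=1..lA. a m t * Q M GA (b k) (c m) * e k s)
       = (\<Sum>k=1..lB. \<Sum>j=1..n. \<Sum>i\<in>{1..j} \<rightarrow>\<^sub>E {1..lA}.
            \<delta> j * b k t * Q M GB (e k) (a (i 1)) * gam M GA a c j i * c (i j) s)) \<and>
    (AE (t, s) in M \<Otimes>\<^sub>M restrict_space M (GA - G).
       (\<Sum>k=1..lB. \<Sum>j=1..n. \<Sum>i\<in>{1..j} \<rightarrow>\<^sub>E {1..lA}.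
            \<delta> j * b k t * Q M GB (e k) (a (i 1)) * gam M GA a c j i * c (i j) s) = 0) \<and>
    (AE (t, s) in M \<Otimes>\<^sub>M restrict_space M (GB - G).
       (\<Sum>k=1..lB. \<delta> 0 * b k t * e k s)
       = (\<Sum>k=1..lB. \<Sum>m=1..lA. Q M GA (b k) (c m) * a m t * e k s))"
proof -
  note M = assms(1) and GA = assms(7) and GB = assms(8) and a = assms(9) and b = assms(10)
    and c = assms(11) and e = assms(12) and G = assms(19)
  have pq: "conjugate_exponents p q" and p: "1 \<le> p"
    using assms(2-4) by (auto simp: conjugate_exponents_def)
  \<comment> \<open>The kernel of \<open>A B - B F(A)\<close> as one finite sum of products: the left summand of the index set
    carries the terms with \<open>e k\<close>, the right one those with \<open>c (i j)\<close>. Cutting off outside \<open>GB\<close> and \<open>GA\<close>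
    makes all factors measurable on the whole space.\<close>
  define I where "I = {1..lB} <+> (SIGMA k:{1..lB}. SIGMA j:{1..n}. {1..j} \<rightarrow>\<^sub>E {1..lA})"
  define w where "w k j i t = \<delta> j * b k t * Q M GB (e k) (a (i 1)) * gam M GA a c j i" for k j i t
  define v where "v k t = (\<Sum>m=1..lA. a m t * Q M GA (b k) (c m)) - \<delta> 0 * b k t" for k t
  define f where "f = case_sum v (\<lambda>(k, j, i) t. - w k j i t)"
  define g where "g = case_sum (\<lambda>k s. indicator GB s * e k s) (\<lambda>(k::nat, j::nat, i) s. indicator GA s * c (i j) s)"
  define K where "K t s = (\<Sum>r\<in>I. f r t * g r s)" for t s
  have finI: "finite I"
    unfolding I_def by (intro finite_Plus finite_SigmaI finite_PiE) auto
  have ij: "i j \<in> {1..lA}" "i 1 \<in> {1..lA}" if "j \<in> {1..n}" "i \<in> {1..j} \<rightarrow>\<^sub>E {1..lA}" for i j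
    using PiE_mem[OF that(2), of j] PiE_mem[OF that(2), of 1] that(1) by simp_all
  have sumI: "(\<Sum>r\<in>I. f r t * h r) = (\<Sum>k=1..lB. v k t * h (Inl k))
      - (\<Sum>k=1..lB. \<Sum>j=1..n. \<Sum>i\<in>{1..j} \<rightarrow>\<^sub>E {1..lA}. w k j i t * h (Inr (k, j, i)))" for t h
  proof -
    have "(\<Sum>r\<in>I. f r t * h r) = (\<Sum>k=1..lB. v k t * h (Inl k)) +
        (\<Sum>(k, j, i)\<in>(SIGMA k:{1..lB}. SIGMA j:{1..n}. {1..j} \<rightarrow>\<^sub>E {1..lA}). - (w k j i t * h (Inr (k, j, i))))"
      unfolding I_def
      by (subst sum.Plus) (auto simp: f_def case_prod_beta intro!: finite_SigmaI finite_PiE sum.cong)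
    also have "(\<Sum>(k, j, i)\<in>(SIGMA k:{1..lB}. SIGMA j:{1..n}. {1..j} \<rightarrow>\<^sub>E {1..lA}). - (w k j i t * h (Inr (k, j, i))))
        = (\<Sum>k=1..lB. \<Sum>j=1..n. \<Sum>i\<in>{1..j} \<rightarrow>\<^sub>E {1..lA}. - (w k j i t * h (Inr (k, j, i))))"
      by (subst sum.Sigma[symmetric], auto intro!: finite_SigmaI finite_PiE sum.cong)
         (subst sum.Sigma[symmetric], auto intro!: finite_PiE sum.cong)
    finally show ?thesis by (simp add: sum_negf)
  qed
  have meas_cut: "(\<lambda>s. indicator S s * u s) \<in> borel_measurable M"
    if "S \<in> sets M" "u \<in> Lp_fun q (restrict_space M S)" for S u
    using Lp_fun_measurable[OF that(2)] that(1) by (simp add: borel_measurable_restrict_space_iff)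
  have int_cut: "integrable M (\<lambda>s. indicator S s * u s * x s)"
    if "S \<in> sets M" "u \<in> Lp_fun q (restrict_space M S)" "x \<in> Lp_fun p M" for S u x
    using set_integrable_Lp_conjugate[OF pq that] by (simp add: set_integrable_def mult.assoc)
  have g_meas: "g r \<in> borel_measurable M" if "r \<in> I" for r
    using that ij c e by (auto simp: I_def g_def intro!: meas_cut GA GB)
  have g_int: "integrable M (\<lambda>s. g r s * x s)" if "r \<in> I" "x \<in> Lp_fun p M" for r x
    using that ij c e by (auto simp: I_def g_def intro!: int_cut GA GB)
  have f_meas: "f r \<in> borel_measurable M" if "r \<in> I" for r
    using that Lp_fun_measurable[OF a] Lp_fun_measurable[OF b]
    by (auto simp: I_def f_def v_def[abs_def] w_def[abs_def]
        intro!: borel_measurable_diff borel_measurable_sum borel_measurable_times borel_measurable_uminus)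
  have [measurable]: "case_prod K \<in> borel_measurable (M \<Otimes>\<^sub>M M)"
    unfolding K_def case_prod_beta
    by (intro borel_measurable_sum borel_measurable_times
        measurable_compose[OF measurable_fst f_meas] measurable_compose[OF measurable_snd g_meas])
  have Q_int: "(LINT s|M. indicator S s * u s * x s) = Q M S u x" for S u x
    by (simp add: Q_def set_lebesgue_integral_def mult.assoc)

  \<comment> \<open>For a fixed \<open>x\<close>, the relation says that the operator with kernel \<open>K\<close> sends \<open>x\<close> to zero.\<close>
  have comm: "A (B (Lp_rel p M `` {x})) = B (op_poly p M \<delta> n A (Lp_rel p M `` {x}))
      \<longleftrightarrow> (AE t in M. (\<Sum>r\<in>I. f r t * (LINT s|M. g r s * x s)) = 0)"
    if x: "x \<in> Lp_fun p M" for x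
  proof -
    let ?A = "rank_op M GA a c lA" and ?B = "rank_op M GB b e lB"
    have AL: "?A y \<in> Lp_fun p M" and BL: "?B y \<in> Lp_fun p M" for y
      using rank_op_in_Lp[OF p] a b by blast+
    have A: "A (Lp_rel p M `` {y}) = Lp_rel p M `` {?A y}" if "y \<in> Lp_fun p M" for y
      by (rule integral_operator_class[OF pq GA a c assms(13) assms(15) that])
    have B: "B (Lp_rel p M `` {y}) = Lp_rel p M `` {?B y}" if "y \<in> Lp_fun p M" for y
      by (rule integral_operator_class[OF pq GB b e assms(14) assms(16) that])
    let ?y = "\<lambda>t. \<Sum>j\<le>n. (?A ^^ j) x t * \<delta> j"
    have pow: "(?A ^^ j) x \<in> Lp_fun p M" for j
      using rank_op_funpow_in_Lp[OF p a x] .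
    have y: "?y \<in> Lp_fun p M"
      using pow by (intro Lp_fun_sum[OF p] Lp_fun_scale_right) auto
    have Qpow: "Q M GB (e k) ((?A ^^ j) x) = (\<Sum>i\<in>{1..j} \<rightarrow>\<^sub>E {1..lA}.
        Q M GB (e k) (a (i 1)) * (gam M GA a c j i * Q M GA (c (i j)) x))"
      if k: "k \<in> {1..lB}" and j: "j \<in> {1..n}" for k j
    proof -
      have "(?A ^^ j) x = (\<lambda>t. \<Sum>i\<in>{1..j} \<rightarrow>\<^sub>E {1..lA}. a (i 1) t * (gam M GA a c j i * Q M GA (c (i j)) x))"
        using j by (intro rank_op_funpow[OF pq GA a c]) auto
      then show ?thesis
        using set_integrable_Lp_conjugate[OF pq GB e[OF k] a] ij[OF j] by (simp only: Q_sum)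
    qed
    have Qy: "Q M GB (e k) ?y = \<delta> 0 * Q M GB (e k) x + (\<Sum>j=1..n. \<Sum>i\<in>{1..j} \<rightarrow>\<^sub>E {1..lA}.
        \<delta> j * Q M GB (e k) (a (i 1)) * gam M GA a c j i * Q M GA (c (i j)) x)"
      if k: "k \<in> {1..lB}" for k
    proof -
      have "Q M GB (e k) ?y = (\<Sum>j\<le>n. Q M GB (e k) ((?A ^^ j) x) * \<delta> j)"
        by (rule Q_sum) (use set_integrable_Lp_conjugate[OF pq GB e] k pow in auto)
      also have "\<dots> = Q M GB (e k) x * \<delta> 0 + (\<Sum>j=1..n. Q M GB (e k) ((?A ^^ j) x) * \<delta> j)"
        by (simp add: atMost_atLeast0 sum.atLeast_Suc_atMost)
      also have "(\<Sum>j=1..n. Q M GB (e k) ((?A ^^ j) x) * \<delta> j)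
          = (\<Sum>j=1..n. \<Sum>i\<in>{1..j} \<rightarrow>\<^sub>E {1..lA}.
        \<delta> j * Q M GB (e k) (a (i 1)) * gam M GA a c j i * Q M GA (c (i j)) x)"
        using k by (intro sum.cong refl) (simp only: Qpow sum_distrib_left mult_ac)
      finally show ?thesis by (simp add: mult.commute)
    qed
    have AB: "?A (?B x) t = (\<Sum>k=1..lB. (\<Sum>m=1..lA. a m t * Q M GA (b k) (c m)) * Q M GB (e k) x)" for t
    proof -
      have "?A (?B x) t = (\<Sum>m=1..lA. a m t * (\<Sum>k=1..lB. Q M GA (b k) (c m) * Q M GB (e k) x))"
        unfolding rank_op_def[of M GA]
      proof (intro sum.cong refl)
        fix m assume m: "m \<in> {1..lA}"
        have "Q M GA (c m) (?B x) = (\<Sum>k=1..lB. Q M GA (c m) (b k) * Q M GB (e k) x)"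
          by (rule Q_rank_op[OF pq GA c[OF m] b])
        then show "a m t * Q M GA (c m) (?B x)
            = a m t * (\<Sum>k=1..lB. Q M GA (b k) (c m) * Q M GB (e k) x)"
          by (simp only: Q_commute[of M GA "c m" "b _"])
      qed
      also have "\<dots> = (\<Sum>k=1..lB. \<Sum>m=1..lA. a m t * (Q M GA (b k) (c m) * Q M GB (e k) x))"
        unfolding sum_distrib_left by (rule sum.swap)
      finally show ?thesis by (simp add: sum_distrib_right mult.assoc)
    qed
    have BF: "?B ?y t = (\<Sum>k=1..lB. \<delta> 0 * b k t * Q M GB (e k) x) + (\<Sum>k=1..lB. \<Sum>j=1..n.
        \<Sum>i\<in>{1..j} \<rightarrow>\<^sub>E {1..lA}. w k j i t * Q M GA (c (i j)) x)" for t
    proof -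
      have "?B ?y t = (\<Sum>k=1..lB. \<delta> 0 * b k t * Q M GB (e k) x + (\<Sum>j=1..n.
        \<Sum>i\<in>{1..j} \<rightarrow>\<^sub>E {1..lA}. w k j i t * Q M GA (c (i j)) x))"
        unfolding rank_op_def[of M GB]
        by (intro sum.cong refl, subst Qy) (simp_all add: w_def ring_distribs sum_distrib_left mult_ac)
      then show ?thesis by (simp only: sum.distrib)
    qed
    have diff: "?A (?B x) t - ?B ?y t = (\<Sum>r\<in>I. f r t * (LINT s|M. g r s * x s))" for t
      unfolding sumI AB BF
      by (simp add: g_def Q_int v_def left_diff_distrib sum_subtractf)
    have "A (B (Lp_rel p M `` {x})) = B (op_poly p M \<delta> n A (Lp_rel p M `` {x}))
        \<longleftrightarrow> Lp_rel p M `` {?A (?B x)} = Lp_rel p M `` {?B ?y}"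
      using op_poly_class[where T = A and \<tau> = ?A and \<delta> = \<delta> and n = n, OF p A AL x] by (simp only: A B x BL y)
    also have "\<dots> \<longleftrightarrow> (AE t in M. ?A (?B x) t - ?B ?y t = 0)"
      using Lp_class_eq_iff[OF AL BL] by simp
    finally show ?thesis by (simp only: diff)
  qed

  have K_eq: "K t s = (\<Sum>k=1..lB. v k t * (indicator GB s * e k s))
      - (\<Sum>k=1..lB. \<Sum>j=1..n. \<Sum>i\<in>{1..j} \<rightarrow>\<^sub>E {1..lA}. w k j i t * (indicator GA s * c (i j) s))" for t s
    unfolding K_def sumI by (simp add: g_def)
  have v_sum: "(\<Sum>k=1..lB. v k t * e k s) = - (\<Sum>k=1..lB. \<delta> 0 * b k t * e k s)
         + (\<Sum>k=1..lB. \<Sum>m=1..lA. a m t * Q M GA (b k) (c m) * e k s)" for t s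
    by (simp add: v_def left_diff_distrib sum_subtractf sum_distrib_right)
  have rest: "(AE (t, s) in M \<Otimes>\<^sub>M restrict_space M S. P t s) \<longleftrightarrow> (AE t in M. AE s in M. s \<in> S \<longrightarrow> K t s = 0)"
    if "S \<in> sets M" "\<And>t s. s \<in> S \<Longrightarrow> P t s \<longleftrightarrow> K t s = 0" for S P
  proof -
    have "(AE (t, s) in M \<Otimes>\<^sub>M restrict_space M S. P t s)
        \<longleftrightarrow> (AE (t, s) in M \<Otimes>\<^sub>M restrict_space M S. K t s = 0)"
      by (rule AE_cong) (use that(2) in \<open>auto simp: space_pair_measure space_restrict_space\<close>)
    then show ?thesis using AE_pair_restrict_space_iff[OF M that(1)] by simp
  qed
  have P1: "- (\<Sum>k=1..lB. \<delta> 0 * b k t * e k s)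
         + (\<Sum>k=1..lB. \<Sum>m=1..lA. a m t * Q M GA (b k) (c m) * e k s)
       = (\<Sum>k=1..lB. \<Sum>j=1..n. \<Sum>i\<in>{1..j} \<rightarrow>\<^sub>E {1..lA}.
            \<delta> j * b k t * Q M GB (e k) (a (i 1)) * gam M GA a c j i * c (i j) s)
       \<longleftrightarrow> K t s = 0" if "s \<in> G" for t s
    using that unfolding v_sum[symmetric] by (simp add: K_eq w_def G)
  have P2: "(\<Sum>k=1..lB. \<Sum>j=1..n. \<Sum>i\<in>{1..j} \<rightarrow>\<^sub>E {1..lA}.
            \<delta> j * b k t * Q M GB (e k) (a (i 1)) * gam M GA a c j i * c (i j) s) = 0
       \<longleftrightarrow> K t s = 0" if "s \<in> GA - G" for t s
    using that by (simp add: K_eq w_def G)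
  have P3: "(\<Sum>k=1..lB. \<delta> 0 * b k t * e k s)
       = (\<Sum>k=1..lB. \<Sum>m=1..lA. Q M GA (b k) (c m) * a m t * e k s)
       \<longleftrightarrow> K t s = 0" if "s \<in> GB - G" for t s
  proof -
    have "s \<in> GB" "s \<notin> GA" using that by (auto simp: G)
    then have "K t s = (\<Sum>k=1..lB. v k t * e k s)" by (simp add: K_eq)
    then have "K t s = - (\<Sum>k=1..lB. \<delta> 0 * b k t * e k s)
        + (\<Sum>k=1..lB. \<Sum>m=1..lA. Q M GA (b k) (c m) * a m t * e k s)"
      unfolding v_sum by (simp only: mult.commute[of "a _ t" "Q M GA _ _"])
    then show ?thesis by linarith
  qed
  have S: "G \<in> sets M" "GA - G \<in> sets M" "GB - G \<in> sets M"
    using GA GB by (auto simp: G)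
  \<comment> \<open>This uses that \<open>K\<close> vanishes outside \<open>GA \<union> GB\<close>.\<close>
  have K_cases: "K t s = 0 \<longleftrightarrow> (s \<in> G \<longrightarrow> K t s = 0) \<and> (s \<in> GA - G \<longrightarrow> K t s = 0) \<and> (s \<in> GB - G \<longrightarrow> K t s = 0)" for t s
    by (cases "s \<in> GA"; cases "s \<in> GB") (auto simp: G K_eq)
  have "(\<forall>u\<in>Lp p M. A (B u) = B (op_poly p M \<delta> n A u)) \<longleftrightarrow> (AE t in M. AE s in M. K t s = 0)"
    unfolding Ball_Lp_iff K_def
    using comm annihilates_Lp_iff_kernel_zero[OF M finI g_meas g_int] by simp
  also have "\<dots> \<longleftrightarrow> (AE t in M. AE s in M. s \<in> G \<longrightarrow> K t s = 0)
      \<and> (AE t in M. AE s in M. s \<in> GA - G \<longrightarrow> K t s = 0)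
      \<and> (AE t in M. AE s in M. s \<in> GB - G \<longrightarrow> K t s = 0)"
    by (subst K_cases) (simp only: AE_conj_iff)
  finally show ?thesis
    by (rule trans, intro arg_cong2[where f = conj] rest[symmetric] S P1 P2 P3)
qed

end
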